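(* If $\frac{4}{3}\le q\le\infty$, then $\mathfrak{p}_2(q)\le \mathfrak{a}_2(q)$, where $\mathfrak{a}_2(q)=2+\frac{2}{2+\frac{2}{q-2}} = 4-\frac{q}{q-1}$ (interpreted as $2$ at $q=2$ and as $3$ at $q=\infty$). If $1\le q<\frac{4}{3}$, then $\mathfrak{p}_2(q)=-1$.
   Context: $\mathbb{T}^d$ is the $d$-fold torus with normalized Haar measure. Every $\psi\in L^q(\mathbb{T}^d)$, $q\ge1$, has Fourier series $\sum_{\alpha\in\mathbb{Z}^d}\widehat\psi(\alpha)z^\alpha$; $H^p(\mathbb{T}^d)$ for $p\ge1$ consists of $\psi\in L^p(\mathbb{T}^d)$ with $\widehat\psi(\alpha)=0$ for $\alpha\notin\mathbb{N}_0^d$, and for $0<p<1$ it is the usual Hardy space on the polydisc identified with boundary values. The Riesz projection is $P_+\psi=\sum_{\alpha\in\mathbb{N}_0^d}\widehat\psi(\alpha)z^\alpha$ (it maps $L^1(\mathbb{T}^d)$ into $H^p(\mathbb{T}^d)$ for all $0<p<1$). For nontrivial $\varphi$ in some $H^p(\mathbb{T}^d)$, $\|\varphi\|_0:=\exp\left(\int_{\mathbb{T}^d}\log|\varphi|\right)$. For $1\le q\le\infty$, $\mathfrak{p}_d(q):=\sup\{p\ge0: \|P_+\psi\|_p\le\|\psi\|_q \text{ for every }\psi\in L^q(\mathbb{T}^d)\}$ if this set is nonempty, and $\mathfrak{p}_d(q):=-1$ otherwise. *)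

theory Defs
  imports "HOL-Analysis.Analysis" "HOL-Probability.Essential_Supremum"
begin

text \<open>The torus T^2 is parametrised by angles (t1,t2) in [0,1)^2 via
  z_j = cis (2 pi t_j); normalized Haar measure is Lebesgue measure on the unit square.\<close>

definition T2 :: "(real \<times> real) measure" where
  "T2 = restrict_space lborel ({0..<1} \<times> {0..<1})"

definition torus_pt :: "real \<Rightarrow> complex" where
  "torus_pt t = cis (2 * pi * t)"

definition fourier :: "(real \<times> real \<Rightarrow> complex) \<Rightarrow> int \<times> int \<Rightarrow> complex" where
  "fourier \<psi> \<alpha> = (\<integral>t. \<psi> t *
       cis (- 2 * pi * (of_int (fst \<alpha>) * fst t + of_int (snd \<alpha>) * snd t)) \<partial>T2)"

definition riesz_ext :: "(real \<times> real \<Rightarrow> complex) \<Rightarrow> complex \<Rightarrow> complex \<Rightarrow> complex" where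
  "riesz_ext \<psi> w1 w2 = (\<Sum>\<^sub>\<infinity>(m,n)\<in>(UNIV :: (nat \<times> nat) set).
       fourier \<psi> (int m, int n) * w1 ^ m * w2 ^ n)"

text \<open>Riesz projection P_+ psi, identified with its boundary values (radial limits;
  set to 0 where the radial limit does not exist, a null set).\<close>
definition riesz_proj :: "(real \<times> real \<Rightarrow> complex) \<Rightarrow> real \<times> real \<Rightarrow> complex" where
  "riesz_proj \<psi> t =
     (let g = (\<lambda>r::real. riesz_ext \<psi> (of_real r * torus_pt (fst t)) (of_real r * torus_pt (snd t)))
      in if (\<exists>l. (g \<longlongrightarrow> l) (at_left 1)) then Lim (at_left 1) g else 0)"

definition pnorm :: "real \<Rightarrow> (real \<times> real \<Rightarrow> complex) \<Rightarrow> ereal" where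
  "pnorm p f = (if integrable T2 (\<lambda>t. cmod (f t) powr p)
                then ereal ((\<integral>t. cmod (f t) powr p \<partial>T2) powr (1 / p)) else \<infinity>)"

text \<open>The geometric mean ||phi||_0 = exp (\<integral> log|phi|); it is 0 when log|phi| is
  not integrable (i.e. = -\<infinity>) or phi vanishes on a set of positive measure.\<close>
definition norm0 :: "(real \<times> real \<Rightarrow> complex) \<Rightarrow> ereal" where
  "norm0 f = (if (AE t in T2. f t \<noteq> 0) \<and> integrable T2 (\<lambda>t. ln (cmod (f t)))
              then ereal (exp (\<integral>t. ln (cmod (f t)) \<partial>T2)) else 0)"

definition hnorm :: "real \<Rightarrow> (real \<times> real \<Rightarrow> complex) \<Rightarrow> ereal" where
  "hnorm p f = (if p = 0 then norm0 f else pnorm p f)"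

definition qnorm :: "ereal \<Rightarrow> (real \<times> real \<Rightarrow> complex) \<Rightarrow> ereal" where
  "qnorm q f = (if q = \<infinity> then esssup T2 (\<lambda>t. ereal (cmod (f t))) else pnorm (real_of_ereal q) f)"

definition in_Lq :: "ereal \<Rightarrow> (real \<times> real \<Rightarrow> complex) \<Rightarrow> bool" where
  "in_Lq q f \<longleftrightarrow> f \<in> borel_measurable T2 \<and> qnorm q f < \<infinity>"

definition good_exps :: "ereal \<Rightarrow> real set" where
  "good_exps q = {p. p \<ge> 0 \<and> (\<forall>\<psi>. in_Lq q \<psi> \<longrightarrow> hnorm p (riesz_proj \<psi>) \<le> qnorm q \<psi>)}"

definition pfrak2 :: "ereal \<Rightarrow> ereal" where
  "pfrak2 q = (if good_exps q = {} then -1 else Sup (ereal ` good_exps q))"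

definition afrak2 :: "ereal \<Rightarrow> real" where
  "afrak2 q = (if q = \<infinity> then 3 else 4 - real_of_ereal q / (real_of_ereal q - 1))"

end

theory Submission
  imports Defs "HOL-Probability.Probability_Measure" "HOL-Real_Asymp.Real_Asymp"
begin

text \<open>Near the unimodular monomial \<open>z\<^sub>1 z\<^sub>2\<close>, whose frequency \<open>(1,1)\<close> is the midpoint of \<open>(2,0)\<close> and
  \<open>(0,2)\<close>, the purely imaginary perturbation \<open>f = z\<^sub>1 z\<^sub>2 (1 + \<i> e u)\<close>, \<open>u = 2 cos \<theta>\<close>,
  \<open>cis \<theta> = z\<^sub>1 / z\<^sub>2\<close>, is analytic and satisfies, with \<open>s = e\<^sup>2\<close>,
  \<open>\<parallel>f\<parallel>\<^sub>p = 1 + s + (p - 4)/4 s\<^sup>2 + O(s\<^sup>3)\<close>. The first-order term does not depend on \<open>p\<close>, so the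
  second-order one decides. Adding \<open>x s z\<^sub>1 z\<^sub>2 cos 2\<theta>\<close>, whose frequencies \<open>(3,-1)\<close> and \<open>(-1,3)\<close> are
  killed by the Riesz projection, gives a preimage \<open>\<psi>\<close> of \<open>f\<close> with
  \<open>\<parallel>\<psi>\<parallel>\<^sub>q = 1 + s + (x\<^sup>2 + (q - 2)(1 + x)\<^sup>2 - 2)/4 s\<^sup>2 + O(s\<^sup>3)\<close>.
  Hence contractivity fails whenever \<open>x\<^sup>2 + (q - 2)(1 + x)\<^sup>2 < p - 2\<close>. For \<open>q > 1\<close> the minimum over \<open>x\<close> is
  \<open>(q - 2)/(q - 1)\<close>, attained at \<open>x = -(q - 2)/(q - 1)\<close>; this gives the exponent \<open>4 - q/(q - 1)\<close>.
  For \<open>q < 4/3\<close> the choice \<open>x = 2\<close> already excludes every \<open>p \<ge> 0\<close>.\<close>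

subsection \<open>Trigonometric polynomials on the torus\<close>

lemma unit_square_borel: "({0..<1} \<times> {0..<1} :: (real \<times> real) set) \<in> sets borel"
  by (auto simp flip: borel_prod)

lemma emeasure_T2_space: "emeasure T2 (space T2) = 1"
proof -
  have "emeasure T2 (space T2) = emeasure (lborel \<Otimes>\<^sub>M lborel) (({0..<1} \<times> {0..<1}) :: (real \<times> real) set)"
    using unit_square_borel by (simp add: T2_def space_restrict_space emeasure_restrict_space lborel_prod)
  also have "\<dots> = emeasure lborel {0..<1::real} * emeasure lborel {0..<1::real}"
    by (rule lborel.emeasure_pair_measure_Times) auto
  finally show ?thesis
    by simp
qed

interpretation T2: prob_space T2
  by (rule prob_spaceI) (rule emeasure_T2_space)

lemma borel_measurable_T2: "f \<in> borel_measurable borel \<Longrightarrow> f \<in> borel_measurable T2"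
  unfolding T2_def by (rule measurable_restrict_space1) simp

definition character :: "int \<times> int \<Rightarrow> real \<times> real \<Rightarrow> complex" where
  "character \<alpha> t = cis (2 * pi * (of_int (fst \<alpha>) * fst t + of_int (snd \<alpha>) * snd t))"

lemma norm_character [simp]: "cmod (character \<alpha> t) = 1"
  by (simp add: character_def)

lemma character_mult: "character \<alpha> t * character \<beta> t = character (\<alpha> + \<beta>) t"
  by (simp add: character_def cis_mult algebra_simps)

lemma character_measurable: "character \<alpha> \<in> borel_measurable borel"
proof -
  have "continuous_on UNIV (character \<alpha>)"
    unfolding character_def cis_conv_exp by (intro continuous_intros)
  thus ?thesis by (rule borel_measurable_continuous_onI)
qed

lemma integrable_character: "integrable T2 (character \<alpha>)"
  by (rule T2.integrable_const_bound[where B = 1])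
     (auto intro: borel_measurable_T2 character_measurable)

text \<open>For \<open>k \<noteq> 0\<close> the antiderivative
  \<open>exp (x *\<^sub>R c) / c\<close> takes the same value at both ends of the period.\<close>

lemma integral_cis_period:
  fixes k :: int
  shows "(\<integral>x. indicator {0..<1::real} x *\<^sub>R cis (2 * pi * (of_int k * x)) \<partial>lborel) = of_bool (k = 0)"
proof -
  \<comment> \<open>Adding the null endpoint 1 closes the interval, as the fundamental theorem of
    calculus requires.\<close>
  have eq: "(\<integral>x. indicator {0..<1::real} x *\<^sub>R cis (2 * pi * (of_int k * x)) \<partial>lborel) =
        (\<integral>x. indicator {0..1::real} x *\<^sub>R cis (2 * pi * (of_int k * x)) \<partial>lborel)" (is "_ = ?I")
  proof (rule integral_cong_AE)
    show "AE x in lborel. indicator {0..<1::real} x *\<^sub>R cis (2 * pi * (of_int k * x)) =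
        indicator {0..1} x *\<^sub>R cis (2 * pi * (of_int k * x))"
      using AE_lborel_singleton[of 1] by eventually_elim (auto simp: indicator_def)
  qed (auto simp: cis_conv_exp)
  show ?thesis
  proof (cases "k = 0")
    case True
    thus ?thesis by (simp add: eq)
  next
    case False
    define c where "c = 2 * pi * of_int k * \<i>"
    have c: "c \<noteq> 0" using False by (simp add: c_def)
    have cis: "cis (2 * pi * (of_int k * x)) = exp (x *\<^sub>R c)" for x
      by (simp add: cis_conv_exp c_def scaleR_conv_of_real mult_ac)
    have "?I = exp (1 *\<^sub>R c) / c - exp (0 *\<^sub>R c) / c"
      unfolding cis
    proof (rule integral_FTC_Icc)
      fix x :: real
      have "((\<lambda>z. exp (z * c) / c) has_field_derivative exp (of_real x * c)) (at (of_real x))"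
        using c by (auto intro!: derivative_eq_intros)
      hence "((\<lambda>x. exp (of_real x * c) / c) has_vector_derivative exp (of_real x * c)) (at x within {0..1})"
        using has_vector_derivative_real_field by blast
      thus "((\<lambda>x. exp (x *\<^sub>R c) / c) has_vector_derivative exp (x *\<^sub>R c)) (at x within {0..1})"
        by (simp add: scaleR_conv_of_real)
    qed (auto intro!: continuous_intros)
    also have "exp (1 *\<^sub>R c) = 1"
      using cis[of 1] by (simp add: cis_multiple_2pi)
    finally show ?thesis using False by (simp add: eq)
  qed
qed

text \<open>By Fubini the integral factors into one period integral per variable.\<close>

lemma integral_character: "(\<integral>t. character \<alpha> t \<partial>T2) = of_bool (\<alpha> = 0)"
proof -
  obtain m n where \<alpha>: "\<alpha> = (m, n)" by fastforce
  define e where "e k x = indicator {0..<1::real} x *\<^sub>R cis (2 * pi * (of_int k * x))" for k x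
  have sets: "{0..<1::real} \<times> {0..<1::real} \<inter> space lborel \<in> sets lborel"
    by (auto simp flip: borel_prod)
  have e: "indicator ({0..<1} \<times> {0..<1}) t *\<^sub>R character \<alpha> t = e m (fst t) * e n (snd t)" for t
    by (cases t) (simp add: \<alpha> e_def character_def indicator_def cis_mult algebra_simps)
  have int: "integrable (lborel \<Otimes>\<^sub>M lborel) (\<lambda>t. e m (fst t) * e n (snd t))"
    using integrable_character[of \<alpha>] sets
    by (simp add: T2_def integrable_restrict_space e lborel_prod)
  have "(\<integral>t. character \<alpha> t \<partial>T2) = (\<integral>t. e m (fst t) * e n (snd t) \<partial>(lborel \<Otimes>\<^sub>M lborel))"
    using sets by (simp add: T2_def integral_restrict_space e lborel_prod)
  also have "\<dots> = (\<integral>x. (\<integral>y. e m x * e n y \<partial>lborel) \<partial>lborel)"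
    using lborel_pair.integral_fst'[OF int] by simp
  also have "\<dots> = (\<integral>x. e m x \<partial>lborel) * (\<integral>y. e n y \<partial>lborel)"
    by simp
  also have "\<dots> = of_bool (\<alpha> = 0)"
    unfolding e_def integral_cis_period by (simp add: \<alpha> zero_prod_def)
  finally show ?thesis .
qed

lemma fourier_trig_poly:
  assumes "finite A"
  shows "fourier (\<lambda>t. \<Sum>\<alpha>\<in>A. a \<alpha> * character \<alpha> t) \<beta> = (if \<beta> \<in> A then a \<beta> else 0)"
proof -
  have "fourier (\<lambda>t. \<Sum>\<alpha>\<in>A. a \<alpha> * character \<alpha> t) \<beta> =
      (\<integral>t. (\<Sum>\<alpha>\<in>A. a \<alpha> * character \<alpha> t) * character (- \<beta>) t \<partial>T2)"
    by (simp add: fourier_def character_def algebra_simps)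
  also have "\<dots> = (\<integral>t. (\<Sum>\<alpha>\<in>A. a \<alpha> * character (\<alpha> - \<beta>) t) \<partial>T2)"
    by (simp add: sum_distrib_right mult.assoc character_mult)
  also have "\<dots> = (\<Sum>\<alpha>\<in>A. a \<alpha> * of_bool (\<alpha> - \<beta> = 0))"
    by (simp add: integrable_character integral_character)
  also have "\<dots> = (\<Sum>\<alpha>\<in>A. if \<beta> = \<alpha> then a \<alpha> else 0)"
    by (intro sum.cong) auto
  finally show ?thesis using assms by simp
qed

text \<open>The extension is a finite sum of monomials in the two disc variables, hence continuous
  in \<open>r\<close>, so the radial limit exists at every point and is the value at
  \<open>r = 1\<close>.\<close>

lemma riesz_proj_trig_poly:
  assumes "finite A"
  shows "riesz_proj (\<lambda>t. \<Sum>\<alpha>\<in>A. a \<alpha> * character \<alpha> t) t =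
    (\<Sum>\<alpha>\<in>A \<inter> {0..} \<times> {0..}. a \<alpha> * character \<alpha> t)"
proof -
  define \<psi> where "\<psi> = (\<lambda>t. \<Sum>\<alpha>\<in>A. a \<alpha> * character \<alpha> t)"
  define N where "N = (\<lambda>\<alpha>. (nat (fst \<alpha>), nat (snd \<alpha>))) ` (A \<inter> {0..} \<times> {0..})"
  have N: "finite N" using assms by (simp add: N_def)
  have inj: "inj_on (\<lambda>\<alpha>. (nat (fst \<alpha>), nat (snd \<alpha>))) (A \<inter> {0..} \<times> {0..})"
    by (auto simp: inj_on_def)
  have ext: "riesz_ext \<psi> w1 w2 =
      (\<Sum>\<alpha>\<in>A \<inter> {0..} \<times> {0..}. a \<alpha> * w1 ^ nat (fst \<alpha>) * w2 ^ nat (snd \<alpha>))" for w1 w2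
  proof -
    have "riesz_ext \<psi> w1 w2 =
        (\<Sum>\<^sub>\<infinity>(m,n)\<in>N. fourier \<psi> (int m, int n) * w1 ^ m * w2 ^ n)"
      unfolding riesz_ext_def
    proof (rule infsum_cong_neutral)
      fix \<nu> :: "nat \<times> nat" assume "\<nu> \<in> UNIV - N"
      obtain m n where \<nu>: "\<nu> = (m, n)" by fastforce
      have "(int m, int n) \<notin> A"
        using \<open>\<nu> \<in> UNIV - N\<close> by (force simp: N_def \<nu> image_iff)
      thus "(case \<nu> of (m, n) \<Rightarrow> fourier \<psi> (int m, int n) * w1 ^ m * w2 ^ n) = 0"
        by (simp add: \<nu> \<psi>_def fourier_trig_poly[OF assms])
    qed auto
    also have "\<dots> = (\<Sum>(m,n)\<in>N. fourier \<psi> (int m, int n) * w1 ^ m * w2 ^ n)"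
      using N by simp
    also have "\<dots> = (\<Sum>\<alpha>\<in>A \<inter> {0..} \<times> {0..}. a \<alpha> * w1 ^ nat (fst \<alpha>) * w2 ^ nat (snd \<alpha>))"
      unfolding N_def sum.reindex[OF inj]
      by (intro sum.cong) (auto simp: \<psi>_def fourier_trig_poly[OF assms])
    finally show ?thesis .
  qed
  define g where "g r = riesz_ext \<psi> (of_real r * torus_pt (fst t)) (of_real r * torus_pt (snd t))"
    for r :: real
  have "isCont g 1"
    unfolding g_def ext by (intro continuous_intros)
  hence lim: "(g \<longlongrightarrow> g 1) (at_left 1)"
    unfolding isCont_def by (rule filterlim_mono) (auto simp: at_le)
  hence "Lim (at_left 1) g = g 1"
    by (intro tendsto_Lim) auto
  hence "riesz_proj \<psi> t = g 1"
    using lim unfolding riesz_proj_def g_def Let_def by auto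
  moreover have char: "character (m, n) t =
      cis (2 * pi * fst t) ^ nat m * cis (2 * pi * snd t) ^ nat n" if "0 \<le> m" "0 \<le> n" for m n
  proof -
    have "cis (2 * pi * fst t) ^ nat m * cis (2 * pi * snd t) ^ nat n =
        cis (real (nat m) * (2 * pi * fst t) + real (nat n) * (2 * pi * snd t))"
      by (simp only: Complex.DeMoivre cis_mult)
    thus ?thesis
      using that by (simp add: character_def algebra_simps)
  qed
  moreover have "g 1 = (\<Sum>\<alpha>\<in>A \<inter> {0..} \<times> {0..}. a \<alpha> * character \<alpha> t)"
    unfolding g_def ext
    by (intro sum.cong) (auto simp: torus_pt_def char)
  ultimately show ?thesis by (simp add: \<psi>_def)
qed

subsection \<open>Second-order expansions\<close>

text \<open>The cosines are real parts of the nontrivial characters of frequency (2,-2) and (4,-4),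
  so the approximating polynomial has mean \<open>k0\<close>. A uniform error bound passes to the
  mean because the measure has total mass 1.\<close>

lemma mean_approx:
  fixes h :: "real \<times> real \<Rightarrow> real"
  assumes h: "h \<in> borel_measurable borel"
    and bound: "\<And>t. \<bar>h t - (k0 + k1 * (2 * cos (4 * pi * (fst t - snd t)))
                       + k2 * (2 * cos (8 * pi * (fst t - snd t))))\<bar> \<le> r"
  shows "integrable T2 h" and "\<bar>(\<integral>t. h t \<partial>T2) - k0\<bar> \<le> r"
proof -
  define c where "c k t = Re (character (k, -k) t)" for k t
  have int_c: "integrable T2 (c k)" for k
    unfolding c_def by (intro integrable_Re integrable_character)
  have mean_c: "(\<integral>t. c k t \<partial>T2) = 0" if "k \<noteq> 0" for k
    unfolding c_def using that
    by (simp add: integral_Re integrable_character integral_character zero_prod_def)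
  define P where "P t = k0 + k1 * (2 * c 2 t) + k2 * (2 * c 4 t)" for t
  have P: "P t = k0 + k1 * (2 * cos (4 * pi * (fst t - snd t)))
                    + k2 * (2 * cos (8 * pi * (fst t - snd t)))" for t
    by (simp add: P_def c_def character_def algebra_simps)
  have int_P: "integrable T2 P"
    unfolding P_def using int_c by simp
  have mean_P: "(\<integral>t. P t \<partial>T2) = k0"
    unfolding P_def using int_c by (simp add: mean_c T2.prob_space)
  have bound': "\<bar>h t - P t\<bar> \<le> r" for t
    using bound by (simp add: P)
  have int_diff: "integrable T2 (\<lambda>t. h t - P t)"
    by (rule T2.integrable_const_bound[where B = r])
       (use bound' int_P borel_measurable_T2[OF h] in auto)
  from Bochner_Integration.integrable_add[OF int_diff int_P] show int_h: "integrable T2 h"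
    by simp
  have "\<bar>\<integral>t. h t - P t \<partial>T2\<bar> \<le> (\<integral>t. \<bar>h t - P t\<bar> \<partial>T2)"
    by (rule integral_abs_bound)
  also have "\<dots> \<le> (\<integral>t. r \<partial>T2)"
    by (rule integral_mono) (use int_diff bound' in auto)
  finally show "\<bar>(\<integral>t. h t \<partial>T2) - k0\<bar> \<le> r"
    by (simp add: T2.prob_space int_h int_P mean_P)
qed

text \<open>A second-order Taylor expansion along \<open>s \<mapsto> 1 + s y + s\<^sup>2 z\<close>, uniform in bounded \<open>y\<close> and \<open>z\<close>.\<close>
lemma taylor_along_parabola:
  fixes g :: "real \<Rightarrow> real"
  assumes g: "(\<lambda>x. g (1 + x) - (g0 + g1 * x + g2 * x\<^sup>2)) \<in> O[at 0](\<lambda>x. x ^ 3)"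
    and g_1: "g 1 = g0"
  obtains K where
    "\<forall>\<^sub>F s in at_right 0. \<forall>y z. \<bar>y\<bar> \<le> R \<longrightarrow> \<bar>z\<bar> \<le> R \<longrightarrow>
       \<bar>g (1 + s * y + s\<^sup>2 * z) - (g0 + s * (g1 * y) + s\<^sup>2 * (g1 * z + g2 * y\<^sup>2))\<bar> \<le> K * s ^ 3"
proof -
  obtain c where "c > 0" and c: "\<forall>\<^sub>F x in at 0. norm (g (1 + x) - (g0 + g1 * x + g2 * x\<^sup>2)) \<le> c * norm (x ^ 3)"
    using landau_o.bigE[OF g] by blast
  then obtain \<delta> where "\<delta> > 0" and \<delta>':
    "\<And>x. x \<noteq> 0 \<Longrightarrow> \<bar>x\<bar> < \<delta> \<Longrightarrow> \<bar>g (1 + x) - (g0 + g1 * x + g2 * x\<^sup>2)\<bar> \<le> c * \<bar>x\<bar> ^ 3"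
    by (auto simp: eventually_at dist_real_def power_abs)
  \<comment> \<open>The Landau bound holds on a punctured neighbourhood only; \<open>g_1\<close>
    supplies the point \<open>x = 0\<close>.\<close>
  have \<delta>: "\<bar>g (1 + x) - (g0 + g1 * x + g2 * x\<^sup>2)\<bar> \<le> c * \<bar>x\<bar> ^ 3" if "\<bar>x\<bar> < \<delta>" for x
    using \<delta>'[of x] that g_1 by (cases "x = 0") auto
  define Q where "Q = \<bar>R\<bar>"
  define K where "K = c * (2 * Q) ^ 3 + \<bar>g2\<bar> * (3 * Q\<^sup>2)"
  have "Q \<ge> 0" by (simp add: Q_def)
  have "\<forall>\<^sub>F s in at_right (0::real). 0 < s \<and> s < 1 \<and> s < \<delta> / (2 * Q + 1)"
    using eventually_at_right_real[of 0 "min 1 (\<delta> / (2 * Q + 1))"] \<open>\<delta> > 0\<close> \<open>Q \<ge> 0\<close>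
    by (auto elim: eventually_mono)
  hence "\<forall>\<^sub>F s in at_right 0. \<forall>y z. \<bar>y\<bar> \<le> R \<longrightarrow> \<bar>z\<bar> \<le> R \<longrightarrow>
       \<bar>g (1 + s * y + s\<^sup>2 * z) - (g0 + s * (g1 * y) + s\<^sup>2 * (g1 * z + g2 * y\<^sup>2))\<bar> \<le> K * s ^ 3"
  proof eventually_elim
    case (elim s)
    hence s: "0 < s" "s < 1" and small: "s * (2 * Q + 1) < \<delta>"
      using \<open>Q \<ge> 0\<close> by (auto simp: field_simps)
    show ?case
    proof (intro allI impI)
      fix y z :: real
      assume "\<bar>y\<bar> \<le> R" "\<bar>z\<bar> \<le> R"
      hence yz: "\<bar>y\<bar> \<le> Q" "\<bar>z\<bar> \<le> Q" by (auto simp: Q_def)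
      define x where "x = s * y + s\<^sup>2 * z"
      have s2: "s\<^sup>2 \<le> s" using s by (simp add: power2_eq_square)
      have s4: "s ^ 4 \<le> s ^ 3" using s by (simp add: power_decreasing)
      have "\<bar>x\<bar> \<le> \<bar>s * y\<bar> + \<bar>s\<^sup>2 * z\<bar>" unfolding x_def by (rule abs_triangle_ineq)
      also have "\<dots> = s * \<bar>y\<bar> + s\<^sup>2 * \<bar>z\<bar>" using s by (simp add: abs_mult)
      also have "\<dots> \<le> s * Q + s * Q"
        using s s2 yz by (intro add_mono mult_mono) auto
      finally have x: "\<bar>x\<bar> \<le> s * (2 * Q)" by (simp add: algebra_simps)
      also have "\<dots> < \<delta>" using small s by (simp add: algebra_simps)
      finally have "\<bar>g (1 + x) - (g0 + g1 * x + g2 * x\<^sup>2)\<bar> \<le> c * \<bar>x\<bar> ^ 3"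
        by (rule \<delta>)
      also have "\<bar>x\<bar> ^ 3 \<le> (s * (2 * Q)) ^ 3"
        using x by (intro power_mono) auto
      finally have 1: "\<bar>g (1 + x) - (g0 + g1 * x + g2 * x\<^sup>2)\<bar> \<le> c * (s * (2 * Q)) ^ 3"
        using \<open>c > 0\<close> by simp
      \<comment> \<open>Squaring \<open>x = s * y + s\<^sup>2 * z\<close> leaves only terms of order
        s^3 and s^4 beyond the claimed expansion.\<close>
      have "g0 + g1 * x + g2 * x\<^sup>2 - (g0 + s * (g1 * y) + s\<^sup>2 * (g1 * z + g2 * y\<^sup>2)) =
          g2 * (s ^ 3 * (2 * (y * z)) + s ^ 4 * z\<^sup>2)"
        by (simp add: x_def power2_eq_square power3_eq_cube power4_eq_xxxx algebra_simps)
      moreover have "\<bar>s ^ 3 * (2 * (y * z)) + s ^ 4 * z\<^sup>2\<bar> \<le> s ^ 3 * (3 * Q\<^sup>2)"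
      proof -
        have "\<bar>s ^ 3 * (2 * (y * z)) + s ^ 4 * z\<^sup>2\<bar> \<le> s ^ 3 * (2 * (\<bar>y\<bar> * \<bar>z\<bar>)) + s ^ 4 * \<bar>z\<bar>\<^sup>2"
          using s by (intro order.trans[OF abs_triangle_ineq]) (simp add: abs_mult)
        also have "\<dots> \<le> s ^ 3 * (2 * (Q * Q)) + s ^ 3 * Q\<^sup>2"
          using s s4 yz \<open>Q \<ge> 0\<close> by (intro add_mono mult_mono power_mono) auto
        also have "\<dots> = s ^ 3 * (3 * Q\<^sup>2)"
          by (simp add: power2_eq_square algebra_simps)
        finally show ?thesis .
      qed
      ultimately have 2: "\<bar>g0 + g1 * x + g2 * x\<^sup>2 - (g0 + s * (g1 * y) + s\<^sup>2 * (g1 * z + g2 * y\<^sup>2))\<bar>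
          \<le> \<bar>g2\<bar> * (s ^ 3 * (3 * Q\<^sup>2))"
        by (simp add: abs_mult mult_left_mono)
      have "c * (s * (2 * Q)) ^ 3 + \<bar>g2\<bar> * (s ^ 3 * (3 * Q\<^sup>2)) = K * s ^ 3"
        by (simp add: K_def power_mult_distrib algebra_simps)
      with 1 2 show "\<bar>g (1 + s * y + s\<^sup>2 * z) - (g0 + s * (g1 * y) + s\<^sup>2 * (g1 * z + g2 * y\<^sup>2))\<bar> \<le> K * s ^ 3"
        by (simp add: x_def algebra_simps)
    qed
  qed
  thus thesis using that by blast
qed

lemma powr_taylor:
  "(\<lambda>x::real. (1 + x) powr a - (1 + a * x + a * (a - 1) / 2 * x\<^sup>2)) \<in> O[at 0](\<lambda>x. x ^ 3)"
  by real_asymp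

text \<open>The trivial coefficients 0 and 1 give the shape that
  \<open>taylor_along_parabola\<close> assumes.\<close>

lemma ln_taylor:
  "(\<lambda>x::real. ln (1 + x) - (0 + 1 * x + - 1 / 2 * x\<^sup>2)) \<in> O[at 0](\<lambda>x. x ^ 3)"
  by real_asymp

subsection \<open>The test functions\<close>

text \<open>This is \<open>z\<^sub>1 z\<^sub>2 (1 + \<i> e u + b C + d D)\<close> for \<open>u = 2 cos \<theta>\<close>, \<open>C = 2 cos 2\<theta>\<close>, \<open>D = 2 cos 4\<theta>\<close>, \<open>cis \<theta> = z\<^sub>1 / z\<^sub>2\<close>.\<close>
definition test_fun :: "real \<Rightarrow> real \<Rightarrow> real \<Rightarrow> real \<times> real \<Rightarrow> complex" where
  "test_fun e b d t = character (1, 1) t *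
     Complex (1 + b * (2 * cos (4 * pi * (fst t - snd t))) + d * (2 * cos (8 * pi * (fst t - snd t))))
             (e * (2 * cos (2 * pi * (fst t - snd t))))"

text \<open>All frequencies have the form (1+k, 1-k) with \<open>k\<close> among 0, 1, -1, 2, -2, 4,
  -4, and the coefficient depends on |k| alone. Each cosine is split into two conjugate
  characters.\<close>

lemma test_fun_trig_poly:
  fixes e b d :: real
  defines "a \<equiv> (\<lambda>\<alpha>::int \<times> int. let k = \<bar>fst \<alpha> - 1\<bar> in
      if k = 0 then 1 else if k = 1 then \<i> * e else if k = 2 then of_real b else of_real d)"
  shows "test_fun e b d =
     (\<lambda>t. \<Sum>\<alpha>\<in>{(1,1),(2,0),(0,2),(3,-1),(-1,3),(5,-3),(-3,5)}. a \<alpha> * character \<alpha> t)"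
proof
  fix t
  have cos_eq: "complex_of_real (2 * cos (x * pi * (fst t - snd t))) =
      character (k, -k) t + character (-k, k) t" if "x = 2 * of_int k" for k x
  proof -
    have "character (k, -k) t = cis (x * pi * (fst t - snd t))"
      "character (-k, k) t = cis (- (x * pi * (fst t - snd t)))"
      by (simp_all add: that character_def algebra_simps)
    thus ?thesis by (simp add: complex_eq_iff)
  qed
  have "test_fun e b d t = character (1, 1) t *
      (1 + of_real b * of_real (2 * cos (4 * pi * (fst t - snd t)))
         + of_real d * of_real (2 * cos (8 * pi * (fst t - snd t)))
         + \<i> * (of_real e * of_real (2 * cos (2 * pi * (fst t - snd t)))))"
    by (simp add: test_fun_def Complex_eq)
  also have "\<dots> = character (1, 1) t *
      (1 + of_real b * (character (2, -2) t + character (-2, 2) t)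
         + of_real d * (character (4, -4) t + character (-4, 4) t)
         + \<i> * (of_real e * (character (1, -1) t + character (-1, 1) t)))"
    by (subst cos_eq[of 2 1], simp, subst cos_eq[of 4 2], simp, subst cos_eq[of 8 4], simp, rule refl)
  finally have "test_fun e b d t = \<dots>" .
  thus "test_fun e b d t = (\<Sum>\<alpha>\<in>{(1,1),(2,0),(0,2),(3,-1),(-1,3),(5,-3),(-3,5)}. a \<alpha> * character \<alpha> t)"
    by (simp add: a_def distrib_left character_mult mult.left_commute[of "character _ _"])
qed

text \<open>The frequencies (1+k, 1-k) with |k| = 2 or 4 have a negative entry, so exactly the
  \<open>b\<close> and \<open>d\<close> terms are removed.\<close>

lemma riesz_proj_test_fun: "riesz_proj (test_fun e b d) = test_fun e 0 0"
proof
  fix t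
  have A: "{(1,1),(2,0),(0,2),(3,-1),(-1,3),(5,-3),(-3,5)} \<inter> {0..} \<times> {0..} = {(1,1),(2,0),(0,2)::int \<times> int}"
    by auto
  show "riesz_proj (test_fun e b d) t = test_fun e 0 0 t"
    unfolding test_fun_trig_poly by (subst riesz_proj_trig_poly) (simp, unfold A, simp)
qed

lemma test_fun_measurable: "test_fun e b d \<in> borel_measurable borel"
  unfolding test_fun_trig_poly by (intro borel_measurable_sum borel_measurable_times character_measurable) auto

context
  fixes t :: "real \<times> real" and u C D :: real
  defines "u \<equiv> 2 * cos (2 * pi * (fst t - snd t))"
    and "C \<equiv> 2 * cos (4 * pi * (fst t - snd t))"
    and "D \<equiv> 2 * cos (8 * pi * (fst t - snd t))"
begin

lemma u_sq: "u\<^sup>2 = 2 + C"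
  using cos_double_cos[of "2 * pi * (fst t - snd t)"]
  by (simp add: u_def C_def power2_eq_square algebra_simps)

lemma C_sq: "C\<^sup>2 = 2 + D"
  using cos_double_cos[of "4 * pi * (fst t - snd t)"]
  by (simp add: D_def C_def power2_eq_square algebra_simps)

lemma abs_C_le: "\<bar>C\<bar> \<le> 2" and abs_D_le: "\<bar>D\<bar> \<le> 2"
  by (simp_all add: C_def D_def abs_mult)

text \<open>The unimodular factor drops out, and the square of the imaginary part is
  \<open>s\<close> times u^2 = 2 + C. With \<open>sqrt s\<close> as amplitude the squared modulus is
  thus polynomial in \<open>s\<close>, \<open>b\<close> and \<open>d\<close>.\<close>

lemma norm_test_fun_sq:
  assumes "s \<ge> 0"
  shows "(cmod (test_fun (sqrt s) b d t))\<^sup>2 = (1 + b * C + d * D)\<^sup>2 + s * (2 + C)"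
proof -
  have "(cmod (test_fun (sqrt s) b d t))\<^sup>2 = (1 + b * C + d * D)\<^sup>2 + (sqrt s * u)\<^sup>2"
    by (simp add: test_fun_def norm_mult complex_norm u_def C_def D_def)
  thus ?thesis using assms by (simp add: power_mult_distrib u_sq)
qed

end

section \<open>Expansions of the norms of the test functions\<close>

lemma eventually_cubic_less_square:
  fixes \<delta> K :: real
  assumes "\<delta> > 0"
  shows "\<forall>\<^sub>F s in at_right 0. K * s ^ 3 < \<delta> * s\<^sup>2"
  using eventually_at_right_real[of 0 "\<delta> / (\<bar>K\<bar> + 1)"]
proof (rule eventually_mono)
  show "0 < \<delta> / (\<bar>K\<bar> + 1)" using assms by simp
next
  fix s assume "s \<in> {0<..<\<delta> / (\<bar>K\<bar> + 1)}"
  hence s: "s > 0" "s * (\<bar>K\<bar> + 1) < \<delta>" by (auto simp: field_simps)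
  have "K * s \<le> s * (\<bar>K\<bar> + 1)" using s by (simp add: mult.commute mult_left_mono)
  hence "K * s < \<delta>" using s by linarith
  hence "(K * s) * s\<^sup>2 < \<delta> * s\<^sup>2" using s by (intro mult_strict_right_mono) auto
  thus "K * s ^ 3 < \<delta> * s\<^sup>2" by (simp add: power2_eq_square power3_eq_cube mult.assoc)
qed

text \<open>This turns a power of the modulus into a power of the squared modulus, to which the
  Taylor expansion applies.\<close>

lemma powr_half_sq: "x \<ge> 0 \<Longrightarrow> (x\<^sup>2) powr (p / 2) = x powr p" for x p :: real
  by (simp add: powr_powr flip: powr_numeral)

lemma eventually_parabola_pos: "\<forall>\<^sub>F s in at_right 0. (1::real) + s + \<gamma> * s\<^sup>2 > 0"
proof -
  have "((\<lambda>s. 1 + s + \<gamma> * s\<^sup>2) \<longlongrightarrow> 1 + 0 + \<gamma> * 0\<^sup>2) (at_right 0)"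
    by (intro tendsto_intros)
  thus ?thesis by (rule order_tendstoD) simp
qed

lemma eventually_at_right_pos: "\<forall>\<^sub>F s in at_right 0. (s::real) > 0"
  by (simp add: eventually_at_right_less)

text \<open>Both sides are compared after raising to the power \<open>p\<close>, so that no
  expansion of the root is needed: the mean of (1 + s(2 + C))^(p/2) against (1 + s + \<gamma>
  s^2)^p.\<close>

lemma pnorm_lower_bound:
  assumes "p > 0" and \<gamma>: "\<gamma> < (p - 4) / 4"
  shows "\<forall>\<^sub>F s in at_right 0. ereal (1 + s + \<gamma> * s\<^sup>2) < pnorm p (test_fun (sqrt s) 0 0)"
proof -
  define a where "a = p / 2"
  obtain K where K: "\<forall>\<^sub>F s in at_right 0. \<forall>y z. \<bar>y\<bar> \<le> 4 \<longrightarrow> \<bar>z\<bar> \<le> 4 \<longrightarrow>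
      \<bar>(1 + s * y + s\<^sup>2 * z) powr a - (1 + s * (a * y) + s\<^sup>2 * (a * z + a * (a - 1) / 2 * y\<^sup>2))\<bar> \<le> K * s ^ 3"
    by (rule taylor_along_parabola[OF powr_taylor, where R = 4]) auto
  obtain L where L: "\<forall>\<^sub>F s in at_right 0. \<forall>y z. \<bar>y\<bar> \<le> max 1 \<bar>\<gamma>\<bar> \<longrightarrow> \<bar>z\<bar> \<le> max 1 \<bar>\<gamma>\<bar> \<longrightarrow>
      \<bar>(1 + s * y + s\<^sup>2 * z) powr p - (1 + s * (p * y) + s\<^sup>2 * (p * z + p * (p - 1) / 2 * y\<^sup>2))\<bar> \<le> L * s ^ 3"
    by (rule taylor_along_parabola[OF powr_taylor, where R = "max 1 \<bar>\<gamma>\<bar>"]) auto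
  \<comment> \<open>This is the difference of the two s^2 coefficients; being positive, it absorbs
    both cubic errors for small \<open>s\<close>.\<close>
  have "p * ((p - 4) / 4 - \<gamma>) > 0"
    using assms by simp
  from eventually_cubic_less_square[OF this, of "K + L"] K L eventually_parabola_pos[of \<gamma>] eventually_at_right_pos
  show ?thesis
  proof eventually_elim
    case (elim s)
    define h where "h t = cmod (test_fun (sqrt s) 0 0 t) powr p" for t
    define M where "M = 1 + s + \<gamma> * s\<^sup>2"
    \<comment> \<open>The means of 2 + C and (2 + C)^2 are 2 and 6.\<close>
    define k0 where "k0 = 1 + s * (2 * a) + s\<^sup>2 * (3 * a * (a - 1))"
    have approx: "\<bar>h t - (k0 + (s * a + s\<^sup>2 * (2 * a * (a - 1))) * (2 * cos (4 * pi * (fst t - snd t)))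
        + (s\<^sup>2 * (a * (a - 1) / 2)) * (2 * cos (8 * pi * (fst t - snd t))))\<bar> \<le> K * s ^ 3" for t
    proof -
      define C where "C = 2 * cos (4 * pi * (fst t - snd t))"
      define D where "D = 2 * cos (8 * pi * (fst t - snd t))"
      have C_sq: "C\<^sup>2 = 2 + D" unfolding C_def D_def by (rule C_sq)
      have "h t = (1 + s * (2 + C) + s\<^sup>2 * 0) powr a"
        using norm_test_fun_sq[of s 0 0 t] elim
        by (simp add: h_def a_def C_def flip: powr_half_sq)
      moreover have "\<bar>2 + C\<bar> \<le> 4"
        using abs_C_le[of t] by (simp add: C_def)
      ultimately have "\<bar>h t - (1 + s * (a * (2 + C)) + s\<^sup>2 * (a * 0 + a * (a - 1) / 2 * (2 + C)\<^sup>2))\<bar> \<le> K * s ^ 3"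
        using elim(2)[rule_format, of "2 + C" 0] by simp
      also have "(2 + C)\<^sup>2 = 6 + 4 * C + D"
        by (simp add: power2_sum C_sq)
      finally show ?thesis
        by (simp add: k0_def C_def D_def field_simps)
    qed
    have meas: "h \<in> borel_measurable borel"
      unfolding h_def using test_fun_measurable by measurable
    note mean = mean_approx[OF meas approx]
    have "M powr p \<le> 1 + s * p + s\<^sup>2 * (p * \<gamma> + p * (p - 1) / 2) + L * s ^ 3"
      using elim(3)[rule_format, of 1 \<gamma>] by (simp add: M_def mult.commute)
    also have "\<dots> < k0 - K * s ^ 3"
      using elim(1) by (simp add: k0_def a_def field_simps power2_eq_square)
    also have "\<dots> \<le> (\<integral>t. h t \<partial>T2)"
      using mean(2) by linarith
    finally have less: "M powr p < (\<integral>t. h t \<partial>T2)" .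
    have "M = (M powr p) powr (1 / p)"
      using elim(4) \<open>p > 0\<close> by (simp add: powr_powr M_def)
    also have "\<dots> < (\<integral>t. h t \<partial>T2) powr (1 / p)"
      using less \<open>p > 0\<close> by (intro powr_less_mono2) auto
    finally show ?case
      using mean(1) by (simp add: pnorm_def h_def M_def)
  qed
qed

text \<open>The logarithmic counterpart at exponent 0; the bound -1 is the value of (p - 4)/4 at p =
  0. Here the mean of half the logarithm of 1 + s(2 + C) is compared with ln(1 + s + \<gamma>
  s^2).\<close>

lemma norm0_lower_bound:
  assumes \<gamma>: "\<gamma> < - 1"
  shows "\<forall>\<^sub>F s in at_right 0. ereal (1 + s + \<gamma> * s\<^sup>2) < norm0 (test_fun (sqrt s) 0 0)"
proof -
  obtain K where K: "\<forall>\<^sub>F s in at_right 0. \<forall>y z. \<bar>y\<bar> \<le> max 4 \<bar>\<gamma>\<bar> \<longrightarrow> \<bar>z\<bar> \<le> max 4 \<bar>\<gamma>\<bar> \<longrightarrow>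
      \<bar>ln (1 + s * y + s\<^sup>2 * z) - (0 + s * (1 * y) + s\<^sup>2 * (1 * z + - 1 / 2 * y\<^sup>2))\<bar> \<le> K * s ^ 3"
    by (rule taylor_along_parabola[OF ln_taylor, where R = "max 4 \<bar>\<gamma>\<bar>"]) auto
  have "- 1 - \<gamma> > 0"
    using assms by simp
  from eventually_cubic_less_square[OF this, of "K / 2 + K"] K eventually_parabola_pos[of \<gamma>] eventually_at_right_pos
  show ?thesis
  proof eventually_elim
    case (elim s)
    define h where "h t = ln (cmod (test_fun (sqrt s) 0 0 t))" for t
    define M where "M = 1 + s + \<gamma> * s\<^sup>2"
    have norm_sq: "(cmod (test_fun (sqrt s) 0 0 t))\<^sup>2 = 1 + s * (2 + 2 * cos (4 * pi * (fst t - snd t)))" for t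
      using norm_test_fun_sq[of s 0 0 t] elim by simp
    \<comment> \<open>The squared modulus is at least 1, so \<open>norm0\<close> takes its
      exponential value and not the default 0.\<close>
    have nonzero: "test_fun (sqrt s) 0 0 t \<noteq> 0" for t
    proof
      assume "test_fun (sqrt s) 0 0 t = 0"
      moreover have "0 \<le> s * (2 + 2 * cos (4 * pi * (fst t - snd t)))"
        using elim abs_C_le[of t] by (intro mult_nonneg_nonneg) auto
      ultimately show False using norm_sq[of t] by simp
    qed
    define k0 where "k0 = s - 3 / 2 * s\<^sup>2"
    have approx: "\<bar>h t - (k0 + (s / 2 - s\<^sup>2) * (2 * cos (4 * pi * (fst t - snd t)))
        + (- (s\<^sup>2 / 4)) * (2 * cos (8 * pi * (fst t - snd t))))\<bar> \<le> K / 2 * s ^ 3" for t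
    proof -
      define C where "C = 2 * cos (4 * pi * (fst t - snd t))"
      define D where "D = 2 * cos (8 * pi * (fst t - snd t))"
      have C_sq: "C\<^sup>2 = 2 + D" unfolding C_def D_def by (rule C_sq)
      have "2 * h t = ln ((cmod (test_fun (sqrt s) 0 0 t))\<^sup>2)"
        using nonzero[of t] by (simp add: h_def ln_realpow)
      hence "2 * h t = ln (1 + s * (2 + C) + s\<^sup>2 * 0)"
        by (simp add: norm_sq C_def)
      moreover have "\<bar>2 + C\<bar> \<le> max 4 \<bar>\<gamma>\<bar>"
        using abs_C_le[of t] by (simp add: C_def)
      ultimately have "\<bar>2 * h t - (0 + s * (1 * (2 + C)) + s\<^sup>2 * (1 * 0 + - 1 / 2 * (2 + C)\<^sup>2))\<bar> \<le> K * s ^ 3"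
        using elim(2)[rule_format, of "2 + C" 0] by simp
      also have "(2 + C)\<^sup>2 = 6 + 4 * C + D"
        by (simp add: power2_sum C_sq)
      finally show ?thesis
        by (simp add: k0_def C_def D_def field_simps abs_le_iff)
    qed
    have meas: "h \<in> borel_measurable borel"
      unfolding h_def using test_fun_measurable by measurable
    note mean = mean_approx[OF meas approx]
    have "ln M \<le> s + s\<^sup>2 * (\<gamma> - 1 / 2) + K * s ^ 3"
      using elim(2)[rule_format, of 1 \<gamma>] by (simp add: M_def mult.commute le_max_iff_disj abs_le_iff)
    also have "\<dots> < k0 - K / 2 * s ^ 3"
      using elim(1) by (simp add: k0_def field_simps)
    also have "\<dots> \<le> (\<integral>t. h t \<partial>T2)"
      using mean(2) by linarith
    finally have "exp (ln M) < exp (\<integral>t. h t \<partial>T2)" by simp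
    thus ?case
      using mean(1) elim(3) nonzero by (simp add: norm0_def h_def M_def)
  qed
qed

text \<open>The squared modulus is 1 + s y + s^2 z with y = 2 + (1 + x) C and z = x^2 C^2 / 4. Then
  \<open>q\<close>-th powers are compared, with the inequalities reversed.\<close>

lemma pnorm_upper_bound:
  assumes "q > 0" and \<gamma>: "x\<^sup>2 / 4 + (q - 2) / 4 * (1 + x)\<^sup>2 - 1 / 2 < \<gamma>"
  shows "\<forall>\<^sub>F s in at_right 0. pnorm q (test_fun (sqrt s) (x / 2 * s) 0) \<le> ereal (1 + s + \<gamma> * s\<^sup>2)"
proof -
  define a where "a = q / 2"
  define R where "R = max (2 + 2 * \<bar>1 + x\<bar>) (x\<^sup>2)"
  obtain K where K: "\<forall>\<^sub>F s in at_right 0. \<forall>y z. \<bar>y\<bar> \<le> R \<longrightarrow> \<bar>z\<bar> \<le> R \<longrightarrow>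
      \<bar>(1 + s * y + s\<^sup>2 * z) powr a - (1 + s * (a * y) + s\<^sup>2 * (a * z + a * (a - 1) / 2 * y\<^sup>2))\<bar> \<le> K * s ^ 3"
    by (rule taylor_along_parabola[OF powr_taylor, where R = R]) auto
  obtain L where L: "\<forall>\<^sub>F s in at_right 0. \<forall>y z. \<bar>y\<bar> \<le> max 1 \<bar>\<gamma>\<bar> \<longrightarrow> \<bar>z\<bar> \<le> max 1 \<bar>\<gamma>\<bar> \<longrightarrow>
      \<bar>(1 + s * y + s\<^sup>2 * z) powr q - (1 + s * (q * y) + s\<^sup>2 * (q * z + q * (q - 1) / 2 * y\<^sup>2))\<bar> \<le> L * s ^ 3"
    by (rule taylor_along_parabola[OF powr_taylor, where R = "max 1 \<bar>\<gamma>\<bar>"]) auto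
  \<comment> \<open>Again the gap between the s^2 coefficients of the two \<open>q\<close>-th
    powers.\<close>
  have "q * (\<gamma> - (x\<^sup>2 / 4 + (q - 2) / 4 * (1 + x)\<^sup>2 - 1 / 2)) > 0"
    using assms by simp
  from eventually_cubic_less_square[OF this, of "K + L"] K L eventually_parabola_pos[of \<gamma>] eventually_at_right_pos
  show ?thesis
  proof eventually_elim
    case (elim s)
    define h where "h t = cmod (test_fun (sqrt s) (x / 2 * s) 0 t) powr q" for t
    define M where "M = 1 + s + \<gamma> * s\<^sup>2"
    \<comment> \<open>The mean of y^2 is 4 + 2(1 + x)^2 and the mean of z is x^2 / 2.\<close>
    define k0 where "k0 = 1 + s * (2 * a) + s\<^sup>2 * (a * x\<^sup>2 / 2 + a * (a - 1) * (2 + (1 + x)\<^sup>2))"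
    have approx: "\<bar>h t - (k0 + (s * a * (1 + x) + s\<^sup>2 * (2 * a * (a - 1) * (1 + x))) * (2 * cos (4 * pi * (fst t - snd t)))
        + (s\<^sup>2 * (a * x\<^sup>2 / 4 + a * (a - 1) / 2 * (1 + x)\<^sup>2)) * (2 * cos (8 * pi * (fst t - snd t))))\<bar> \<le> K * s ^ 3" for t
    proof -
      define C where "C = 2 * cos (4 * pi * (fst t - snd t))"
      define D where "D = 2 * cos (8 * pi * (fst t - snd t))"
      define y where "y = 2 + (1 + x) * C"
      define z where "z = x\<^sup>2 / 4 * (2 + D)"
      have C_sq: "C\<^sup>2 = 2 + D" unfolding C_def D_def by (rule C_sq)
      have "(cmod (test_fun (sqrt s) (x / 2 * s) 0 t))\<^sup>2 = (1 + x / 2 * s * C)\<^sup>2 + s * (2 + C)"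
        using norm_test_fun_sq[of s "x / 2 * s" 0 t] elim by (simp add: C_def)
      also have "\<dots> = 1 + s * y + s\<^sup>2 * z"
        by (simp add: y_def z_def power2_sum power_mult_distrib C_sq power_divide algebra_simps)
      finally have "h t = (1 + s * y + s\<^sup>2 * z) powr a"
        by (simp add: h_def a_def flip: powr_half_sq)
      moreover have "\<bar>y\<bar> \<le> R"
      proof -
        have "\<bar>y\<bar> \<le> 2 + \<bar>1 + x\<bar> * \<bar>C\<bar>"
          unfolding y_def by (intro order.trans[OF abs_triangle_ineq]) (simp add: abs_mult)
        also have "\<dots> \<le> 2 + \<bar>1 + x\<bar> * 2"
          using abs_C_le[of t] by (intro add_mono mult_left_mono) (auto simp: C_def)
        finally show ?thesis by (simp add: R_def)
      qed
      moreover have "\<bar>z\<bar> \<le> R"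
      proof -
        have "\<bar>z\<bar> = x\<^sup>2 / 4 * \<bar>2 + D\<bar>" by (simp add: z_def abs_mult)
        also have "\<dots> \<le> x\<^sup>2 / 4 * 4"
          using abs_D_le[of t] by (intro mult_left_mono) (auto simp: D_def)
        finally show ?thesis by (simp add: R_def)
      qed
      ultimately have "\<bar>h t - (1 + s * (a * y) + s\<^sup>2 * (a * z + a * (a - 1) / 2 * y\<^sup>2))\<bar> \<le> K * s ^ 3"
        using elim(2) by simp
      also have "y\<^sup>2 = 4 + 4 * (1 + x) * C + (1 + x)\<^sup>2 * (2 + D)"
        by (simp add: y_def power2_sum[of 2] power_mult_distrib C_sq)
      also have "1 + s * (a * y) + s\<^sup>2 * (a * z + a * (a - 1) / 2 * (4 + 4 * (1 + x) * C + (1 + x)\<^sup>2 * (2 + D))) =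
          k0 + (s * a * (1 + x) + s\<^sup>2 * (2 * a * (a - 1) * (1 + x))) * C
             + (s\<^sup>2 * (a * x\<^sup>2 / 4 + a * (a - 1) / 2 * (1 + x)\<^sup>2)) * D"
        by (simp add: k0_def y_def z_def field_simps)
      finally show ?thesis
        by (simp only: C_def D_def)
    qed
    have meas: "h \<in> borel_measurable borel"
      unfolding h_def using test_fun_measurable by measurable
    note mean = mean_approx[OF meas approx]
    have "(\<integral>t. h t \<partial>T2) \<le> k0 + K * s ^ 3"
      using mean(2) by linarith
    also have "\<dots> < 1 + s * q + s\<^sup>2 * (q * \<gamma> + q * (q - 1) / 2) - L * s ^ 3"
      using elim(1) by (simp add: k0_def a_def field_simps power2_eq_square)
    also have "\<dots> \<le> M powr q"
      using elim(3)[rule_format, of 1 \<gamma>] by (simp add: M_def mult.commute)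
    finally have less: "(\<integral>t. h t \<partial>T2) < M powr q" .
    have "(\<integral>t. h t \<partial>T2) powr (1 / q) \<le> (M powr q) powr (1 / q)"
      using less \<open>q > 0\<close> by (intro powr_mono2) (auto simp: h_def)
    also have "\<dots> = M"
      using elim(4) \<open>q > 0\<close> by (simp add: powr_powr M_def)
    finally show ?case
      using mean(1) by (simp add: pnorm_def h_def M_def)
  qed
qed

text \<open>At order \<open>s\<^sup>2\<close>, the \<open>D\<close>-term makes the modulus of the test function constant.\<close>
lemma qnorm_infinity_upper_bound:
  assumes \<gamma>: "\<gamma> > - 1 / 4"
  shows "\<forall>\<^sub>F s in at_right 0. qnorm \<infinity> (test_fun (sqrt s) (- s / 2) (- s\<^sup>2 / 8)) \<le> ereal (1 + s + \<gamma> * s\<^sup>2)"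
proof -
  \<comment> \<open>The square of 1 + s + \<gamma> s^2 has s^2 coefficient 1 + 2 \<gamma>, to be
    compared with 1/2. The factor 1 - 2 \<gamma> below collects an error of at most s^3 and the
    cubic term of this square.\<close>
  have "2 * \<gamma> + 1 / 2 > 0" using \<gamma> by simp
  from eventually_cubic_less_square[OF this, of "1 - 2 * \<gamma>"] eventually_parabola_pos[of \<gamma>]
    eventually_at_right_real[of 0 "1::real", OF zero_less_one]
  show ?thesis
  proof eventually_elim
    case (elim s)
    define \<psi> where "\<psi> = test_fun (sqrt s) (- s / 2) (- s\<^sup>2 / 8)"
    have s: "0 < s" "s < 1" using elim by auto
    have "cmod (\<psi> t) \<le> 1 + s + \<gamma> * s\<^sup>2" for t
    proof (rule power2_le_imp_le)
      define C where "C = 2 * cos (4 * pi * (fst t - snd t))"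
      define D where "D = 2 * cos (8 * pi * (fst t - snd t))"
      have C_sq: "C\<^sup>2 = 2 + D" unfolding C_def D_def by (rule C_sq)
      have C: "\<bar>C\<bar> \<le> 2" and D: "\<bar>D\<bar> \<le> 2"
        unfolding C_def D_def by (rule abs_C_le abs_D_le)+
      have "(cmod (\<psi> t))\<^sup>2 = (1 + - s / 2 * C + - s\<^sup>2 / 8 * D)\<^sup>2 + s * (2 + C)"
        unfolding \<psi>_def C_def D_def by (rule norm_test_fun_sq) (use s in simp)
      \<comment> \<open>The choice b = -s/2, which is x = -1, cancels the terms linear in C; d =
        -s^2/8 then cancels the D left by C^2 = 2 + D.\<close>
      also have "\<dots> = 1 + 2 * s + s\<^sup>2 / 4 * C\<^sup>2 - s\<^sup>2 / 4 * D + s ^ 3 / 8 * (C * D) + s ^ 4 / 64 * D\<^sup>2"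
        by (simp add: power2_eq_square power3_eq_cube power4_eq_xxxx field_simps)
      also have "\<dots> = 1 + 2 * s + s\<^sup>2 / 2 + s ^ 3 / 8 * (C * D) + s ^ 4 / 64 * D\<^sup>2"
        by (simp add: C_sq field_simps)
      also have "\<dots> \<le> 1 + 2 * s + s\<^sup>2 / 2 + s ^ 3 / 8 * 4 + s ^ 3 / 64 * 4"
      proof (intro add_mono mult_left_mono mult_mono)
        have "\<bar>C\<bar> * \<bar>D\<bar> \<le> 2 * 2" using C D by (intro mult_mono) auto
        thus "C * D \<le> 4" by (simp add: abs_le_iff flip: abs_mult)
        show "D\<^sup>2 \<le> 4" using D power_mono[of "\<bar>D\<bar>" 2 2] by simp
        show "s ^ 4 / 64 \<le> s ^ 3 / 64" using s by (simp add: power_decreasing)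
      qed (use s in auto)
      also have "\<dots> \<le> 1 + 2 * s + s\<^sup>2 / 2 + s ^ 3" using s by simp
      also have "\<dots> \<le> 1 + 2 * s + (1 + 2 * \<gamma>) * s\<^sup>2 + 2 * \<gamma> * s ^ 3"
        using elim(1) by (simp add: field_simps)
      also have "\<dots> \<le> (1 + 2 * s + (1 + 2 * \<gamma>) * s\<^sup>2 + 2 * \<gamma> * s ^ 3) + (\<gamma> * s\<^sup>2)\<^sup>2"
        by simp
      also have "\<dots> = (1 + s + \<gamma> * s\<^sup>2)\<^sup>2"
        by (simp add: power2_eq_square power3_eq_cube algebra_simps)
      finally show "(cmod (\<psi> t))\<^sup>2 \<le> (1 + s + \<gamma> * s\<^sup>2)\<^sup>2" .
    qed (use elim in simp)
    moreover have "(\<lambda>t. ereal (cmod (\<psi> t))) \<in> borel_measurable T2"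
      unfolding \<psi>_def using borel_measurable_T2[OF test_fun_measurable] by measurable
    ultimately have "esssup T2 (\<lambda>t. ereal (cmod (\<psi> t))) \<le> ereal (1 + s + \<gamma> * s\<^sup>2)"
      by (intro esssup_I) auto
    thus ?case by (simp add: qnorm_def \<psi>_def)
  qed
qed

section \<open>Failure of contractivity and the resulting exponents\<close>

lemma hnorm_lower_bound:
  assumes "p \<ge> 0" and "\<gamma> < (p - 4) / 4"
  shows "\<forall>\<^sub>F s in at_right 0. ereal (1 + s + \<gamma> * s\<^sup>2) < hnorm p (riesz_proj (test_fun (sqrt s) (b s) (d s)))"
  using pnorm_lower_bound[of p \<gamma>] norm0_lower_bound[of \<gamma>] assms
  by (cases "p = 0") (auto simp: hnorm_def riesz_proj_test_fun)

text \<open>The parabola 1 + s + \<gamma> s^2 separates the two norms for all small s > 0, and a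
  single such \<open>s\<close> already gives a counterexample. Its finite upper bound also puts the
  function into the \<open>q\<close> space.\<close>

lemma not_good_exps:
  assumes "p \<ge> 0" and "\<gamma> < (p - 4) / 4"
    and upper: "\<forall>\<^sub>F s in at_right 0. qnorm q (test_fun (sqrt s) (b s) (d s)) \<le> ereal (1 + s + \<gamma> * s\<^sup>2)"
  shows "p \<notin> good_exps q"
proof -
  have "\<forall>\<^sub>F s in at_right (0::real). p \<notin> good_exps q"
    using hnorm_lower_bound[OF assms(1,2), of b d] upper
  proof eventually_elim
    case (elim s)
    let ?\<psi> = "test_fun (sqrt s) (b s) (d s)"
    have "in_Lq q ?\<psi>"
      unfolding in_Lq_def using elim borel_measurable_T2[OF test_fun_measurable]
      by (auto intro: order.strict_trans1)
    moreover have "\<not> hnorm p (riesz_proj ?\<psi>) \<le> qnorm q ?\<psi>"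
      using elim by simp
    ultimately show ?case by (auto simp: good_exps_def)
  qed
  thus ?thesis by (simp add: eventually_const)
qed

lemma not_good_exps_finite:
  assumes "p \<ge> 0" "q > 0" "x\<^sup>2 + (q - 2) * (1 + x)\<^sup>2 < p - 2"
  shows "p \<notin> good_exps (ereal q)"
proof -
  have "x\<^sup>2 / 4 + (q - 2) / 4 * (1 + x)\<^sup>2 - 1 / 2 < (p - 4) / 4"
    using assms(3) by (simp add: field_simps)
  \<comment> \<open>Any value strictly between the s^2 coefficients of the two norms will
    do.\<close>
  then obtain \<gamma> where "x\<^sup>2 / 4 + (q - 2) / 4 * (1 + x)\<^sup>2 - 1 / 2 < \<gamma>" "\<gamma> < (p - 4) / 4"
    using dense by blast
  thus ?thesis
    using assms pnorm_upper_bound[of q x \<gamma>]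
    by (intro not_good_exps[where b = "\<lambda>s. x / 2 * s" and d = "\<lambda>_. 0"]) (auto simp: qnorm_def)
qed

text \<open>The coefficients -1/4 and (p - 4)/4 agree exactly at p = 3.\<close>

lemma not_good_exps_infinity:
  assumes "p > 3"
  shows "p \<notin> good_exps \<infinity>"
proof -
  obtain \<gamma> where "- 1 / 4 < \<gamma>" "\<gamma> < (p - 4) / 4"
    using dense[of "- 1 / 4" "(p - 4) / 4"] assms by auto
  thus ?thesis
    using assms qnorm_infinity_upper_bound[of \<gamma>] by (intro not_good_exps) auto
qed

lemma four_thirds: "(4 / 3 :: ereal) = ereal (4 / 3)"
  by simp

theorem theorem3:
  fixes q :: ereal
  shows "(4/3 \<le> q \<and> q \<le> \<infinity> \<longrightarrow> pfrak2 q \<le> ereal (afrak2 q))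
       \<and> (1 \<le> q \<and> q < 4/3 \<longrightarrow> pfrak2 q = -1)"
proof (intro conjI impI)
  assume q: "4/3 \<le> q \<and> q \<le> \<infinity>"
  have "afrak2 q \<ge> 0 \<and> (\<forall>p\<in>good_exps q. p \<le> afrak2 q)"
  proof (cases "q = \<infinity>")
    case True
    thus ?thesis
      using not_good_exps_infinity by (force simp: afrak2_def)
  next
    case False
    then obtain r where r: "q = ereal r"
      using q by (cases q) auto
    have "r \<ge> 4 / 3"
      using q by (simp add: r four_thirds)
    \<comment> \<open>The minimiser of x^2 + (r - 2)(1 + x)^2.\<close>
    define x where "x = - (r - 2) / (r - 1)"
    have a: "afrak2 q = 4 - r / (r - 1)"
      by (simp add: afrak2_def r)
    have "x\<^sup>2 + (r - 2) * (1 + x)\<^sup>2 = afrak2 q - 2"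
    proof -
      \<comment> \<open>In terms of \<open>v\<close> one has 1 + x = v and r - 2 = 1/v - 1, and the
        minimum becomes 1 - v.\<close>
      define v where "v = 1 / (r - 1)"
      have v: "r = 1 + 1 / v" "v \<noteq> 0" using \<open>r \<ge> 4 / 3\<close> by (auto simp: v_def)
      have xa: "x = v - 1" "afrak2 q = 3 - v"
        using \<open>r \<ge> 4 / 3\<close> by (simp_all add: x_def a v_def field_simps)
      show ?thesis unfolding xa using v by (simp add: field_simps power2_eq_square)
    qed
    hence "p \<notin> good_exps q" if "p > afrak2 q" "p \<ge> 0" for p
      unfolding r using that \<open>r \<ge> 4 / 3\<close> by (intro not_good_exps_finite[where x = x]) (auto simp: r)
    \<comment> \<open>Equivalent to r \<ge> 4/3; it also covers an empty \<open>good_exps q\<close>,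
      where \<open>pfrak2 q\<close> is -1.\<close>
    moreover have "afrak2 q \<ge> 0"
      using \<open>r \<ge> 4 / 3\<close> by (simp add: a field_simps)
    ultimately show ?thesis by (force simp: good_exps_def)
  qed
  thus "pfrak2 q \<le> ereal (afrak2 q)"
    by (auto simp: pfrak2_def intro!: Sup_least order.trans[of "-1" 0 "ereal (afrak2 q)"])
next
  assume q: "1 \<le> q \<and> q < 4/3"
  then obtain r where r: "q = ereal r"
    by (cases q) auto
  have "1 \<le> r" "r < 4 / 3"
    using q by (simp_all add: r one_ereal_def four_thirds)
  \<comment> \<open>The value x = 2 is the minimiser at r = 4/3. It turns the condition into 9 r -
    12 < p, whose left side is negative for r < 4/3.\<close>
  hence "p \<notin> good_exps q" for p
    unfolding r using not_good_exps_finite[of p r 2]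
    by (cases "p \<ge> 0") (auto simp: good_exps_def field_simps)
  hence "good_exps q = {}" by blast
  thus "pfrak2 q = -1"
    by (simp add: pfrak2_def)
qed

end
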